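(* Let $z_1,\dots,z_m\in\mathbb{R}^n$, let $L=\operatorname{conv}\{z_1,\dots,z_m\}$, and let $\rho\in L$ be the projection of the origin onto $L$. Let $\alpha^*=(\alpha_1^*,\dots,\alpha_m^* )$ be an optimal solution of the problem $$\min\ \Bigl\|\sum_{i=1}^m\alpha_i z_i\Bigr\|^2\quad\text{subject to}\quad \sum_{i=1}^m\alpha_i=1,\quad \alpha_i\ge 0,\ i=1,\dots,m.$$ Then $$\rho=\sum_{i=1}^m\alpha_i^* z_i .$$
   Context: Here $m\ge 1$, $\langle\cdot,\cdot\rangle$ and $\|\cdot\|$ are the Euclidean inner product and norm. The projection $\rho$ of the origin onto $L$ is the unique point of $L$ at which $\min_{z\in L}\|z\|^2$ is attained. *)

theory Defs
  imports "HOL-Analysis.Analysis"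
begin

end

theory Submission
  imports Defs
begin

text \<open>
  Every point of \<open>L\<close> is a convex combination of the \<open>z i\<close> and conversely, so the two problems
  minimise the squared norm over the same set of points, and both minimisers are points of \<open>L\<close> at
  the least distance from the origin. A convex set has at most one such point, because the midpoint
  of two distinct points of equal norm has a smaller norm; hence the minimisers coincide.
  The weights themselves need not be unique: the \<open>z i\<close> may repeat or be affinely dependent.
\<close>

text \<open>
  The family may repeat points, so weights on the points of the image would first have to be split
  among the indices. That is avoided by checking that the convex combinations of the family form
  the least convex set that contains every member.
\<close>

lemma convex_hull_finite_family:
  fixes z :: "'i \<Rightarrow> 'a::real_vector"
  assumes "finite I"
  shows "convex hull (z ` I) = {\<Sum>i\<in>I. a i *\<^sub>R z i | a. sum a I = 1 \<and> (\<forall>i\<in>I. 0 \<le> a i)}"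
    (is "_ = ?C")
proof (rule hull_unique)
  show "z ` I \<subseteq> ?C"
  proof clarify
    fix j assume "j \<in> I"
    then show "\<exists>a. z j = (\<Sum>i\<in>I. a i *\<^sub>R z i) \<and> sum a I = 1 \<and> (\<forall>i\<in>I. (0::real) \<le> a i)"
      using assms
      by (intro exI[of _ "\<lambda>i. if i = j then 1 else 0"]) (simp add: if_distrib[of "\<lambda>t. t *\<^sub>R _"] cong: if_cong)
  qed
  show "convex ?C"
  proof (rule convexI, clarify)
    fix u v :: real and a b :: "'i \<Rightarrow> real"
    assume "0 \<le> u" "0 \<le> v" "u + v = 1" "sum a I = 1" "sum b I = 1"
      "\<forall>i\<in>I. 0 \<le> a i" "\<forall>i\<in>I. 0 \<le> b i"
    then show "\<exists>c. u *\<^sub>R (\<Sum>i\<in>I. a i *\<^sub>R z i) + v *\<^sub>R (\<Sum>i\<in>I. b i *\<^sub>R z i) = (\<Sum>i\<in>I. c i *\<^sub>R z i)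
        \<and> sum c I = 1 \<and> (\<forall>i\<in>I. 0 \<le> c i)"
      by (intro exI[of _ "\<lambda>i. u * a i + v * b i"])
        (simp add: scaleR_left_distrib scaleR_sum_right sum.distrib flip: sum_distrib_left)
  qed
  show "?C \<subseteq> T" if "z ` I \<subseteq> T" "convex T" for T
    using that assms by (auto intro!: convex_sum)
qed

theorem lemma3p9:
  fixes m :: nat and z :: "nat \<Rightarrow> real ^ 'n" and L :: "(real ^ 'n) set"
    and \<rho> :: "real ^ 'n" and \<alpha> :: "nat \<Rightarrow> real"
  assumes m: "m \<ge> 1"
    and L: "L = convex hull (z ` {1..m})"
    and proj: "is_arg_min (\<lambda>x. (norm x)\<^sup>2) (\<lambda>x. x \<in> L) \<rho>"
    and opt: "is_arg_min (\<lambda>a :: nat \<Rightarrow> real. (norm (\<Sum>i = 1..m. a i *\<^sub>R z i))\<^sup>2)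
                (\<lambda>a. (\<Sum>i = 1..m. a i) = 1 \<and> (\<forall>i\<in>{1..m}. a i \<ge> 0)) \<alpha>"
  shows "\<rho> = (\<Sum>i = 1..m. \<alpha> i *\<^sub>R z i)"
proof (rule any_closest_point_unique[of L _ _ 0])
  have combinations: "L = {\<Sum>i = 1..m. a i *\<^sub>R z i | a. sum a {1..m} = 1 \<and> (\<forall>i\<in>{1..m}. 0 \<le> a i)}"
    unfolding L by (rule convex_hull_finite_family) simp
  show "convex L" "closed L"
    unfolding L by (simp_all add: compact_convex_hull finite_imp_compact compact_imp_closed)
  show "\<rho> \<in> L" "\<forall>x\<in>L. dist 0 \<rho> \<le> dist 0 x"
    using proj by (auto simp: is_arg_min_linorder)
  show "(\<Sum>i = 1..m. \<alpha> i *\<^sub>R z i) \<in> L"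
    using opt unfolding combinations is_arg_min_linorder by blast
  show "\<forall>x\<in>L. dist 0 (\<Sum>i = 1..m. \<alpha> i *\<^sub>R z i) \<le> dist 0 x"
    using opt unfolding combinations by (auto simp: is_arg_min_linorder)
qed

end
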